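(* Let $G$ be a second-countable locally compact amenable unimodular group, let $k \in \mathbb{N}$, and let $\Lambda \subseteq G$ be a uniform $k$-approximate lattice. Let $(\pi, \mathcal{H}_{\pi})$ be an irreducible, square-integrable projective unitary representation of $G$ of formal degree $d_{\pi} > 0$. If there exists $g \in \mathcal{H}_{\pi}$ such that $\pi(\Lambda) g$ is complete in $\mathcal{H}_{\pi}$, then $$D^-(\Lambda) \geq d_{\pi}/k,$$ where $D^-(\Lambda)$ denotes the lower Beurling density of $\Lambda$ in $G$.
   Context: Fix a Haar measure $\mu$ on $G$. Approximate lattices. A set $\Lambda \subseteq G$ is relatively dense if there is a compact $K \subseteq G$ with $\Lambda K = G$; it is uniformly discrete if there is a non-empty open set $V \subseteq G$ with $|\Lambda \cap xV| \leq 1$ for all $x \in G$; it is a Delone set if it is both. $\Lambda$ is a $k$-approximate subgroup if (a1) $e \in \Lambda$; (a2) $\Lambda^{-1} = \Lambda$; (a3) there is a finite set $F \subseteq G$ with $|F| \leq k$ and $\Lambda^2 \subseteq F\Lambda$, where $\Lambda^2 = \{\lambda\lambda' : \lambda,\lambda' \in \Lambda\}$. A uniform $k$-approximate lattice is a $k$-approximate subgroup that is also a Delone set. Beurling density. A (right) strong Følner sequence in $G$ is a sequence $(K_n)_{n\in\mathbb{N}}$ of non-null compact sets such that for all compact $K \subseteq G$ one has $\mu(K_n \triangle K_nK)/\mu(K_n) \to 0$ and $\mu(K_nK \cap K_n^cK)/\mu(K_n) \to 0$ as $n \to \infty$, where $K_n^c = G \setminus K_n$. Such a sequence exists in every second-countable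 amenable group. The lower Beurling density is $D^-(\Lambda) = \liminf_{n\to\infty} \inf_{x\in G} |\Lambda \cap xK_n|/\mu(K_n)$; it does not depend on the choice of strong Følner sequence. Representations. A projective unitary representation of $G$ is a strongly continuous map $\pi: G \to \mathcal{U}(\mathcal{H}_\pi)$ into the unitary operators on a Hilbert space with $\pi(x)\pi(y) = \sigma(x,y)\pi(xy)$ for all $x,y\in G$, for some (2-cocycle) $\sigma: G\times G \to \mathbb{T}$. It is irreducible if $\{0\}$ and $\mathcal{H}_\pi$ are the only closed $\pi(G)$-invariant subspaces. An irreducible $\pi$ is square-integrable (a discrete series) if there is a non-zero $g \in \mathcal{H}_\pi$ with $\int_G |\langle g,\pi(x)g\rangle|^2\,d\mu(x) < \infty$; then its formal degree is the number $d_\pi > 0$ such that $\int_G |\langle f,\pi(x)g\rangle|^2\,d\mu(x) = d_\pi^{-1}\|f\|^2\|g\|^2$ for all $f,g\in\mathcal{H}_\pi$ (same Haar measure $\mu$ as in the densities). Coherent systems. $\pi(\Lambda)g$ denotes the family $(\pi(\lambda)g)_{\lambda\in\Lambda}$. It is complete in $\mathcal{H}_\pi$ if its closed linear span is $\mathcal{H}_\pi$. *)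

theory Defs
  imports "HOL-Analysis.Analysis"
begin

section \<open>Complex Hilbert spaces\<close>

text \<open>
  The inner product \<open>cinner\<close> is linear in its first and conjugate-linear in its
  second argument.
\<close>

class complex_inner = real_normed_vector +
  fixes scaleC :: "complex \<Rightarrow> 'a \<Rightarrow> 'a"
    and cinner :: "'a \<Rightarrow> 'a \<Rightarrow> complex"
  assumes scaleC_add_right: "scaleC a (x + y) = scaleC a x + scaleC a y"
    and scaleC_add_left: "scaleC (a + b) x = scaleC a x + scaleC b x"
    and scaleC_scaleC: "scaleC a (scaleC b x) = scaleC (a * b) x"
    and scaleC_one: "scaleC 1 x = x"
    and scaleR_scaleC: "scaleR r x = scaleC (complex_of_real r) x"
    and cinner_add_left: "cinner (x + y) z = cinner x z + cinner y z"
    and cinner_scaleC_left: "cinner (scaleC a x) y = a * cinner x y"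
    and cinner_commute: "cinner x y = cnj (cinner y x)"
    and cinner_self: "cinner x x = complex_of_real ((norm x)\<^sup>2)"

class complex_hilbert_space = complex_inner + complete_space

global_interpretation complex_vector:
  vector_space "scaleC :: complex \<Rightarrow> 'a \<Rightarrow> 'a::complex_inner"
  by unfold_locales (simp_all add: scaleC_add_right scaleC_add_left scaleC_scaleC scaleC_one)

definition unitary_operator :: "('h::complex_hilbert_space \<Rightarrow> 'h) \<Rightarrow> bool" where
  "unitary_operator U \<longleftrightarrow>
     Vector_Spaces.linear scaleC scaleC U \<and> surj U \<and>
     (\<forall>f g. cinner (U f) (U g) = cinner f g)"

section \<open>The group and its Haar measure\<close>

text \<open>
  The group \<open>G\<close> is the universe of a type of class \<^class>\<open>topological_group_add\<close>. This
  class does not assume commutativity; the group law is merely written additively, so the product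
  \<open>x y\<close> reads \<open>x + y\<close>, the inverse reads \<open>- x\<close> and the identity reads \<open>0\<close>. For sets,
  \<open>A + B\<close> is the product set, whereas \<open>- A\<close> is the complement; the set of inverses is
  \<open>uminus ` A\<close>.
\<close>

text \<open>
  All groups considered are second countable, locally compact and Hausdorff; on them a Borel
  measure that is finite on compact sets is automatically regular, so regularity is not required
  separately.
\<close>

definition haar_measure :: "'g::topological_group_add measure \<Rightarrow> bool" where
  "haar_measure \<mu> \<longleftrightarrow>
     sets \<mu> = sets borel \<and>
     emeasure \<mu> UNIV \<noteq> 0 \<and>
     (\<forall>K. compact K \<longrightarrow> emeasure \<mu> K < \<infinity>) \<and>
     (\<forall>x. \<forall>A \<in> sets borel. emeasure \<mu> ((\<lambda>y. x + y) ` A) = emeasure \<mu> A)"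

definition unimodular :: "'g::topological_group_add measure \<Rightarrow> bool" where
  "unimodular \<mu> \<longleftrightarrow>
     (\<forall>x. \<forall>A \<in> sets borel. emeasure \<mu> ((\<lambda>y. y + x) ` A) = emeasure \<mu> A)"

definition essentially_bounded :: "'g measure \<Rightarrow> ('g \<Rightarrow> real) set" where
  "essentially_bounded \<mu> = {f \<in> borel_measurable \<mu>. \<exists>C. AE x in \<mu>. \<bar>f x\<bar> \<le> C}"

text \<open>
  A left-invariant mean on \<open>L\<^sup>\<infinity>(G, \<mu>)\<close>, as a functional on representatives. Linearity together
  with positivity on almost everywhere non-negative functions forces it to be constant on classes
  of almost everywhere equal functions.
\<close>

definition left_invariant_mean :: "'g::topological_group_add measure \<Rightarrow> (('g \<Rightarrow> real) \<Rightarrow> real) \<Rightarrow> bool"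
  where
  "left_invariant_mean \<mu> m \<longleftrightarrow>
     (\<forall>f \<in> essentially_bounded \<mu>. \<forall>h \<in> essentially_bounded \<mu>.
        m (\<lambda>y. f y + h y) = m f + m h) \<and>
     (\<forall>c. \<forall>f \<in> essentially_bounded \<mu>. m (\<lambda>y. c * f y) = c * m f) \<and>
     (\<forall>f \<in> essentially_bounded \<mu>. (AE y in \<mu>. 0 \<le> f y) \<longrightarrow> 0 \<le> m f) \<and>
     m (\<lambda>_. 1) = 1 \<and>
     (\<forall>x. \<forall>f \<in> essentially_bounded \<mu>. m (\<lambda>y. f (- x + y)) = m f)"

definition amenable :: "'g::topological_group_add measure \<Rightarrow> bool" where
  "amenable \<mu> \<longleftrightarrow> (\<exists>m. left_invariant_mean \<mu> m)"

section \<open>Approximate lattices\<close>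

definition relatively_dense :: "'g::topological_group_add set \<Rightarrow> bool" where
  "relatively_dense \<Lambda> \<longleftrightarrow> (\<exists>K. compact K \<and> \<Lambda> + K = UNIV)"

definition uniformly_discrete :: "'g::topological_group_add set \<Rightarrow> bool" where
  "uniformly_discrete \<Lambda> \<longleftrightarrow>
     (\<exists>V. open V \<and> V \<noteq> {} \<and>
        (\<forall>x. finite (\<Lambda> \<inter> (\<lambda>y. x + y) ` V) \<and> card (\<Lambda> \<inter> (\<lambda>y. x + y) ` V) \<le> 1))"

definition delone :: "'g::topological_group_add set \<Rightarrow> bool" where
  "delone \<Lambda> \<longleftrightarrow> relatively_dense \<Lambda> \<and> uniformly_discrete \<Lambda>"

definition approximate_subgroup :: "nat \<Rightarrow> 'g::group_add set \<Rightarrow> bool" where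
  "approximate_subgroup k \<Lambda> \<longleftrightarrow>
     0 \<in> \<Lambda> \<and> uminus ` \<Lambda> = \<Lambda> \<and>
     (\<exists>F. finite F \<and> card F \<le> k \<and> \<Lambda> + \<Lambda> \<subseteq> F + \<Lambda>)"

definition uniform_approximate_lattice :: "nat \<Rightarrow> 'g::topological_group_add set \<Rightarrow> bool" where
  "uniform_approximate_lattice k \<Lambda> \<longleftrightarrow> approximate_subgroup k \<Lambda> \<and> delone \<Lambda>"

section \<open>Strong Folner sequences and Beurling density\<close>

text \<open>
  The test sets \<open>K\<close> are required to be non-empty: for \<open>K = {}\<close> the first quotient equals \<open>1\<close>.
\<close>

definition strong_folner :: "'g::topological_group_add measure \<Rightarrow> (nat \<Rightarrow> 'g set) \<Rightarrow> bool" where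
  "strong_folner \<mu> Ks \<longleftrightarrow>
     (\<forall>n. compact (Ks n) \<and> emeasure \<mu> (Ks n) \<noteq> 0) \<and>
     (\<forall>K. compact K \<and> K \<noteq> {} \<longrightarrow>
        (\<lambda>n. measure \<mu> (sym_diff (Ks n) (Ks n + K)) / measure \<mu> (Ks n)) \<longlonglongrightarrow> 0 \<and>
        (\<lambda>n. measure \<mu> ((Ks n + K) \<inter> (- Ks n + K)) / measure \<mu> (Ks n)) \<longlonglongrightarrow> 0)"

text \<open>
  The number of points is taken in \<^typ>\<open>ennreal\<close>, so that infinite sets count as \<open>\<infinity>\<close>.
\<close>

definition lower_beurling_density ::
  "'g::topological_group_add measure \<Rightarrow> (nat \<Rightarrow> 'g set) \<Rightarrow> 'g set \<Rightarrow> ennreal" where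
  "lower_beurling_density \<mu> Ks \<Lambda> =
     liminf (\<lambda>n. INF x. emeasure (count_space UNIV) (\<Lambda> \<inter> (\<lambda>y. x + y) ` Ks n) / emeasure \<mu> (Ks n))"

section \<open>Projective unitary representations\<close>

definition two_cocycle :: "('g::group_add \<Rightarrow> 'g \<Rightarrow> complex) \<Rightarrow> bool" where
  "two_cocycle \<sigma> \<longleftrightarrow>
     (\<forall>x y. cmod (\<sigma> x y) = 1) \<and>
     (\<forall>x y z. \<sigma> x y * \<sigma> (x + y) z = \<sigma> x (y + z) * \<sigma> y z)"

definition projective_unitary_rep ::
  "('g::topological_group_add \<Rightarrow> 'h::complex_hilbert_space \<Rightarrow> 'h) \<Rightarrow> bool" where
  "projective_unitary_rep \<pi> \<longleftrightarrow>
     (\<forall>x. unitary_operator (\<pi> x)) \<and>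
     (\<forall>f. continuous_on UNIV (\<lambda>x. \<pi> x f)) \<and>
     (\<exists>\<sigma>. two_cocycle \<sigma> \<and> (\<forall>x y f. \<pi> x (\<pi> y f) = scaleC (\<sigma> x y) (\<pi> (x + y) f)))"

definition irreducible_rep :: "('g \<Rightarrow> 'h::complex_hilbert_space \<Rightarrow> 'h) \<Rightarrow> bool" where
  "irreducible_rep \<pi> \<longleftrightarrow>
     (\<forall>V. complex_vector.subspace V \<and> closed V \<and> (\<forall>x. \<pi> x ` V \<subseteq> V) \<longrightarrow> V = {0} \<or> V = UNIV)"

definition square_integrable_rep ::
  "'g measure \<Rightarrow> ('g \<Rightarrow> 'h::complex_hilbert_space \<Rightarrow> 'h) \<Rightarrow> bool" where
  "square_integrable_rep \<mu> \<pi> \<longleftrightarrow>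
     (\<exists>g. g \<noteq> 0 \<and> (\<integral>\<^sup>+ x. ennreal ((cmod (cinner g (\<pi> x g)))\<^sup>2) \<partial>\<mu>) < \<infinity>)"

definition has_formal_degree ::
  "'g measure \<Rightarrow> ('g \<Rightarrow> 'h::complex_hilbert_space \<Rightarrow> 'h) \<Rightarrow> real \<Rightarrow> bool" where
  "has_formal_degree \<mu> \<pi> d \<longleftrightarrow>
     0 < d \<and>
     (\<forall>f g. (\<integral>\<^sup>+ x. ennreal ((cmod (cinner f (\<pi> x g)))\<^sup>2) \<partial>\<mu>)
              = ennreal ((norm f)\<^sup>2 * (norm g)\<^sup>2 / d))"

definition complete_system ::
  "('g \<Rightarrow> 'h::complex_hilbert_space \<Rightarrow> 'h) \<Rightarrow> 'g set \<Rightarrow> 'h \<Rightarrow> bool" where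
  "complete_system \<pi> \<Lambda> g \<longleftrightarrow> closure (complex_vector.span ((\<lambda>x. \<pi> x g) ` \<Lambda>)) = UNIV"

end

theory Submission
  imports Defs
begin

text \<open>
  Let \<open>\<phi>\<close> be a unit vector. Completeness of \<open>\<pi>(\<Lambda>)g\<close>, relative density of \<open>\<Lambda>\<close> and translation by
  elements of \<open>\<Lambda>\<close> show that every \<open>\<pi>(z)\<phi>\<close> is \<open>\<epsilon>\<close>-close to the span of the \<open>\<pi>(\<gamma>)g\<close> with
  \<open>\<gamma> \<in> \<Lambda>\<^sup>2 \<inter> zL\<close>, for one compact set \<open>L\<close>. So all \<open>\<pi>(z)\<phi>\<close> with \<open>z \<in> xK\<^sub>n\<close> are \<open>\<epsilon>\<close>-close to a space
  of dimension at most \<open>|\<Lambda>\<^sup>2 \<inter> xK\<^sub>nL|\<close>, and integrating the square norms of their projections against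
  the orthogonality relations gives \<open>|\<Lambda>\<^sup>2 \<inter> xK\<^sub>nL| \<ge> d (1 - \<epsilon>\<^sup>2) \<mu>(K\<^sub>n)\<close>. Since
  \<open>\<Lambda>\<^sup>2 = (\<Lambda>\<^sup>2)\<^sup>-\<^sup>1 \<subseteq> \<Lambda>F\<^sup>-\<^sup>1\<close>, the left-hand side is at most \<open>k |\<Lambda> \<inter> xK\<^sub>nLF|\<close>, and the
  points of \<open>\<Lambda>\<close> in \<open>x(K\<^sub>nLF - K\<^sub>n)\<close> are negligible because \<open>\<Lambda>\<close> is uniformly discrete and \<open>K\<^sub>n\<close> is a
  strong Folner sequence.
\<close>

section \<open>Complex inner product spaces\<close>

lemma cinner_add_right:
  fixes x :: "'a::complex_inner"
  shows "cinner x (y + z) = cinner x y + cinner x z"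
  by (metis cinner_add_left cinner_commute complex_cnj_add)

lemma cinner_scaleC_right:
  fixes x :: "'a::complex_inner"
  shows "cinner x (scaleC a y) = cnj a * cinner x y"
  by (metis cinner_commute cinner_scaleC_left complex_cnj_mult)

lemma additive_cinner_left: "Modules.additive (\<lambda>x::'a::complex_inner. cinner x y)"
  by standard (rule cinner_add_left)

lemma additive_cinner_right: "Modules.additive (cinner (x::'a::complex_inner))"
  by standard (rule cinner_add_right)

lemmas cinner_diff_left = Modules.additive.diff[OF additive_cinner_left]
  and cinner_sum_left = Modules.additive.sum[OF additive_cinner_left]
  and cinner_zero_right = Modules.additive.zero[OF additive_cinner_right]
  and cinner_sum_right = Modules.additive.sum[OF additive_cinner_right]

lemma norm_scaleC: "norm (scaleC a x) = cmod a * norm (x::'a::complex_inner)"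
proof -
  have "complex_of_real ((norm (scaleC a x))\<^sup>2) = complex_of_real ((cmod a * norm x)\<^sup>2)"
    by (simp only: cinner_self[symmetric] cinner_scaleC_left cinner_scaleC_right)
      (simp add: cinner_self power_mult_distrib complex_norm_square mult.assoc del: of_real_power)
  then show ?thesis
    by (simp only: of_real_eq_iff power2_eq_iff_nonneg norm_ge_zero mult_nonneg_nonneg)
qed

lemma cmod_cinner_commute: "cmod (cinner x y) = cmod (cinner y (x::'a::complex_inner))"
  by (metis cinner_commute complex_mod_cnj)

lemma norm_add_sq_orthogonal:
  fixes x :: "'a::complex_inner"
  assumes "cinner x y = 0"
  shows "(norm (x + y))\<^sup>2 = (norm x)\<^sup>2 + (norm y)\<^sup>2"
proof -
  have "cinner y x = 0" using assms cinner_commute[of y x] by simp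
  then have "complex_of_real ((norm (x + y))\<^sup>2) = complex_of_real ((norm x)\<^sup>2 + (norm y)\<^sup>2)"
    unfolding of_real_add cinner_self[symmetric] by (simp add: cinner_add_left cinner_add_right assms)
  then show ?thesis by (simp only: of_real_eq_iff)
qed

text \<open>Cauchy-Schwarz: the component of \<open>x\<close> along \<open>y\<close> is
  \<open>scaleC c y\<close>, and by Pythagoras it is no longer than \<open>x\<close>.\<close>

lemma cmod_cinner_le: "cmod (cinner x y) \<le> norm x * norm (y::'a::complex_inner)"
proof (cases "y = 0")
  case True then show ?thesis by (simp add: cinner_zero_right)
next
  case False
  define c where "c = cinner x y / of_real ((norm y)\<^sup>2)"
  have c: "cmod c = cmod (cinner x y) / (norm y)\<^sup>2"
    by (simp add: c_def norm_divide norm_power)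
  have "cinner (x - scaleC c y) (scaleC c y) = 0"
    using False by (simp add: cinner_scaleC_right cinner_diff_left cinner_scaleC_left cinner_self c_def)
  from norm_add_sq_orthogonal[OF this] have "(norm (scaleC c y))\<^sup>2 \<le> (norm x)\<^sup>2" by simp
  then have "cmod c * norm y \<le> norm x"
    by (simp add: norm_scaleC power2_le_iff_abs_le)
  then show ?thesis
    using False unfolding c by (simp add: field_simps power2_eq_square)
qed

lemma continuous_on_cinner_right: "continuous_on UNIV (cinner (x::'a::complex_inner))"
proof -
  have "bounded_linear (cinner x)"
    by (rule bounded_linear_intro[where K = "norm x"])
      (auto simp: cinner_add_right scaleR_scaleC cinner_scaleC_right scaleR_conv_of_real
        intro: cmod_cinner_le order_trans[OF cmod_cinner_le] mult.commute[THEN eq_refl])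
  then show ?thesis by (rule linear_continuous_on)
qed

section \<open>Orthogonal projection and finite-dimensional approximation\<close>

definition orthonormal :: "'a::complex_inner set \<Rightarrow> bool" where
  "orthonormal E \<longleftrightarrow> (\<forall>e\<in>E. \<forall>f\<in>E. cinner e f = (if e = f then 1 else 0))"

definition orth_proj :: "'a::complex_inner set \<Rightarrow> 'a \<Rightarrow> 'a" where
  "orth_proj E u = (\<Sum>e\<in>E. scaleC (cinner u e) e)"

lemma orth_proj_in_span: "orth_proj E u \<in> complex_vector.span E"
  unfolding orth_proj_def
  by (intro complex_vector.span_sum complex_vector.span_scale complex_vector.span_base)

lemma cinner_orth_proj:
  assumes "orthonormal E" "finite E" "e \<in> E"
  shows "cinner (orth_proj E u) e = cinner u e"
proof -
  have "cinner (orth_proj E u) e = (\<Sum>f\<in>E. if f = e then cinner u e else 0)"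
    unfolding orth_proj_def cinner_sum_left cinner_scaleC_left
    using assms by (intro sum.cong) (auto simp: orthonormal_def)
  then show ?thesis using assms by simp
qed

lemma orth_proj_residual:
  assumes "orthonormal E" "finite E" "v \<in> complex_vector.span E"
  shows "cinner (u - orth_proj E u) v = 0"
  using assms(3)
proof (induction rule: complex_vector.span_induct_alt)
  case base then show ?case by (rule cinner_zero_right)
next
  case (step c x y)
  then show ?case
    by (simp add: cinner_add_right cinner_scaleC_right cinner_diff_left cinner_orth_proj[OF assms(1,2)])
qed

lemma norm_orth_proj_sq:
  assumes "orthonormal E" "finite E"
  shows "(norm (orth_proj E u))\<^sup>2 = (\<Sum>e\<in>E. (cmod (cinner e u))\<^sup>2)"
proof -
  have "complex_of_real ((norm (orth_proj E u))\<^sup>2) = cinner (orth_proj E u) (orth_proj E u)"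
    by (simp add: cinner_self)
  also have "\<dots> = cinner u (orth_proj E u)"
    using orth_proj_residual[OF assms orth_proj_in_span, of u u] by (simp add: cinner_diff_left)
  also have "\<dots> = (\<Sum>e\<in>E. cnj (cinner u e) * cinner u e)"
    unfolding orth_proj_def
    by (simp add: cinner_sum_right cinner_scaleC_right)
  also have "\<dots> = (\<Sum>e\<in>E. complex_of_real ((cmod (cinner e u))\<^sup>2))"
    by (simp add: cmod_cinner_commute[of _ u] complex_norm_square mult.commute del: of_real_power)
  finally show ?thesis by (simp only: of_real_sum[symmetric] of_real_eq_iff)
qed

text \<open>By Pythagoras \<open>u - orth_proj E u\<close> is no longer than \<open>u - v\<close>,
  and the sum is the square norm of the projection. Closeness to a span thus becomes a lower bound
  on coefficients that can be integrated over the group.\<close>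

lemma bessel_approximation:
  assumes "orthonormal E" "finite E" "v \<in> complex_vector.span E"
  shows "(norm u)\<^sup>2 - (norm (u - v))\<^sup>2 \<le> (\<Sum>e\<in>E. (cmod (cinner e u))\<^sup>2)"
proof -
  let ?p = "orth_proj E u"
  have "(norm ((u - ?p) + (?p - v)))\<^sup>2 = (norm (u - ?p))\<^sup>2 + (norm (?p - v))\<^sup>2"
    by (intro norm_add_sq_orthogonal orth_proj_residual assms(1,2)
        complex_vector.span_diff orth_proj_in_span assms(3))
  moreover have "(norm ((u - ?p) + ?p))\<^sup>2 = (norm (u - ?p))\<^sup>2 + (norm ?p)\<^sup>2"
    by (intro norm_add_sq_orthogonal orth_proj_residual assms(1,2) orth_proj_in_span)
  ultimately show ?thesis
    using norm_orth_proj_sq[OF assms(1,2), of u] by simp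
qed

text \<open>Gram-Schmidt: each new vector contributes its normalised residual, or nothing when it
  already lies in the span.\<close>

lemma orthonormal_spanning_set:
  fixes B :: "'a::complex_inner set"
  assumes "finite B"
  shows "\<exists>E. finite E \<and> card E \<le> card B \<and> orthonormal E \<and> B \<subseteq> complex_vector.span E"
  using assms
proof induction
  case empty then show ?case by (auto simp: orthonormal_def)
next
  case (insert b B)
  then obtain E where E: "finite E" "card E \<le> card B" "orthonormal E" "B \<subseteq> complex_vector.span E"
    by blast
  define r where "r = b - orth_proj E b"
  show ?case
  proof (cases "r = 0")
    case True
    then have "b \<in> complex_vector.span E" using orth_proj_in_span[of E b] by (simp add: r_def)
    then show ?thesis using E insert.hyps by (intro exI[of _ E]) auto
  next
    case False
    define e where "e = scaleC (1 / of_real (norm r)) r"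
    have e1: "cinner e e = 1"
      using False by (simp add: cinner_self e_def norm_scaleC norm_divide)
    have e0: "cinner e f = 0" if "f \<in> E" for f
      using orth_proj_residual[OF E(3,1) complex_vector.span_base[OF that], of b]
      by (simp add: e_def cinner_scaleC_left r_def)
    have e0': "cinner f e = 0" if "f \<in> E" for f
      using e0[OF that] cinner_commute[of f e] by simp
    have "scaleC (of_real (norm r)) e = r"
      using False by (simp add: e_def scaleC_scaleC scaleC_one)
    then have "b = orth_proj E b + scaleC (of_real (norm r)) e" by (simp add: r_def)
    moreover have "orth_proj E b \<in> complex_vector.span (insert e E)"
      using orth_proj_in_span complex_vector.span_mono subset_insertI by blast
    ultimately have "b \<in> complex_vector.span (insert e E)"
      by (metis complex_vector.span_add complex_vector.span_scale complex_vector.span_base insertI1)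
    moreover have "B \<subseteq> complex_vector.span (insert e E)"
      using E(4) complex_vector.span_mono[of E "insert e E"] by blast
    moreover have "orthonormal (insert e E)"
      using E(3) e1 e0 e0' by (auto simp: orthonormal_def)
    moreover have "card (insert e E) \<le> card (insert b B)"
      using E(1,2) insert.hyps by (simp add: card_insert_if)
    ultimately show ?thesis using E(1) by (intro exI[of _ "insert e E"]) auto
  qed
qed

text \<open>Finitely many balls of radius \<open>\<epsilon>/2\<close> cover \<open>C\<close>, and
  each centre is \<open>\<epsilon>/2\<close>-close to a finite linear combination of elements of
  \<open>S\<close>.\<close>

lemma span_closure_finite_approx:
  fixes S :: "'a::complex_inner set"
  assumes "compact C" "C \<subseteq> closure (complex_vector.span S)" "\<epsilon> > 0"
  shows "\<exists>T. finite T \<and> T \<subseteq> S \<and> (\<forall>u\<in>C. \<exists>v\<in>complex_vector.span T. norm (u - v) \<le> \<epsilon>)"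
proof -
  have "C \<subseteq> (\<Union>c\<in>C. ball c (\<epsilon>/2))" using assms(3) by auto
  then obtain X where X: "X \<subseteq> C" "finite X" "C \<subseteq> (\<Union>c\<in>X. ball c (\<epsilon>/2))"
    using compactE_image[OF assms(1), of C "\<lambda>c. ball c (\<epsilon>/2)"] by auto
  have "\<exists>T. finite T \<and> T \<subseteq> S \<and> (\<exists>v\<in>complex_vector.span T. dist v c < \<epsilon>/2)" if "c \<in> X" for c
  proof -
    have "c \<in> closure (complex_vector.span S)" using that X assms by blast
    then obtain v where v: "v \<in> complex_vector.span S" "dist v c < \<epsilon>/2"
      using assms(3) closure_approachable by (metis half_gt_zero)
    from v(1) obtain t r where "finite t" "t \<subseteq> S" "v = (\<Sum>a\<in>t. scaleC (r a) a)"
      unfolding complex_vector.span_explicit by blast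
    then have "v \<in> complex_vector.span t"
      by (simp only:) (intro complex_vector.span_sum complex_vector.span_scale complex_vector.span_base)
    then show ?thesis using \<open>finite t\<close> \<open>t \<subseteq> S\<close> v(2) by blast
  qed
  then obtain T where T: "\<And>c. c \<in> X \<Longrightarrow> finite (T c) \<and> T c \<subseteq> S \<and>
      (\<exists>v\<in>complex_vector.span (T c). dist v c < \<epsilon>/2)" by metis
  have "\<exists>v\<in>complex_vector.span (\<Union>(T ` X)). norm (u - v) \<le> \<epsilon>" if u: "u \<in> C" for u
  proof -
    obtain c where c: "c \<in> X" "dist c u < \<epsilon>/2"
      using subsetD[OF X(3) u] by (auto simp: mem_ball)
    obtain v where v: "v \<in> complex_vector.span (T c)" "dist v c < \<epsilon>/2" using T c(1) by blast
    have "dist u v \<le> \<epsilon>" using c(2) v(2) by (metis dist_commute dist_triangle_half_r less_imp_le)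
    moreover have "v \<in> complex_vector.span (\<Union>(T ` X))"
      using v(1) c(1) complex_vector.span_mono[of "T c" "\<Union>(T ` X)"] by blast
    ultimately show ?thesis by (auto simp: dist_norm)
  qed
  then show ?thesis using X(2) T by (intro exI[of _ "\<Union>(T ` X)"]) auto
qed

section \<open>Topological groups\<close>

lemma compact_set_plus:
  fixes A :: "'a::topological_monoid_add set"
  assumes "compact A" "compact B"
  shows "compact (A + B)"
proof -
  have "compact ((\<lambda>p. fst p + snd p) ` (A \<times> B))"
    using assms by (intro compact_continuous_image compact_Times continuous_intros)
  then show ?thesis by (simp add: set_plus_image case_prod_beta)
qed

lemma left_translation_eq_vimage:
  "(\<lambda>y. x + y) ` A = (\<lambda>y. - x + y) -` (A :: 'a::group_add set)"
proof (intro set_eqI iffI)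
  fix z assume "z \<in> (\<lambda>y. - x + y) -` A"
  then show "z \<in> (\<lambda>y. x + y) ` A" by (intro image_eqI[of _ _ "- x + z"]) simp_all
qed auto

lemma open_left_translation:
  "open A \<Longrightarrow> open ((\<lambda>y. x + y) ` (A :: 'a::topological_group_add set))"
  unfolding left_translation_eq_vimage by (intro open_vimage continuous_intros)

lemma borel_left_translation:
  "A \<in> sets borel \<Longrightarrow> (\<lambda>y. x + y) ` (A :: 'a::topological_group_add set) \<in> sets borel"
  unfolding left_translation_eq_vimage
  by (rule measurable_sets_borel[OF borel_measurable_continuous_onI]) (intro continuous_intros)

text \<open>A union of right translates of \<open>A\<close>. It makes the Folner boundary, a compact
  set intersected with an open one, Borel.\<close>

lemma open_set_plus_left:
  fixes A :: "'a::topological_group_add set"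
  assumes "open A"
  shows "open (A + B)"
proof -
  have "A + B = (\<Union>b\<in>B. (\<lambda>y. y + - b) -` A)"
  proof (intro set_eqI iffI)
    fix z assume "z \<in> (\<Union>b\<in>B. (\<lambda>y. y + - b) -` A)"
    then obtain b where "b \<in> B" "z + - b \<in> A" by blast
    then show "z \<in> A + B" using set_plus_intro[of "z + - b" A b B] by (simp add: add.assoc)
  next
    fix z assume "z \<in> A + B"
    then obtain a b where "a \<in> A" "b \<in> B" "z = a + b" by (rule set_plus_elim)
    then show "z \<in> (\<Union>b\<in>B. (\<lambda>y. y + - b) -` A)" by (intro UN_I[of b]) simp_all
  qed
  moreover have "open \<dots>" using assms by (intro open_UN ballI open_vimage continuous_intros)
  ultimately show ?thesis by simp
qed

lemma left_translation_set_plus: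
  fixes A :: "'a::semigroup_add set"
  shows "(\<lambda>y. x + y) ` A + B = (\<lambda>y. x + y) ` (A + B)"
proof -
  have "(\<lambda>y. x + y) ` A = {x} + A" for A :: "'a set" by (auto simp: set_plus_def)
  then show ?thesis by (simp add: add.assoc)
qed

text \<open>By Lindelof, countably many left translates of \<open>W\<close> cover the group, which
  would be null if \<open>W\<close> were.\<close>

lemma haar_measure_open_pos:
  fixes \<mu> :: "'g::{topological_group_add, second_countable_topology} measure"
  assumes \<mu>: "haar_measure \<mu>" and W: "open W" "W \<noteq> {}"
  shows "emeasure \<mu> W \<noteq> 0"
proof
  assume 0: "emeasure \<mu> W = 0"
  obtain w where "w \<in> W" using W by blast
  let ?\<F> = "range (\<lambda>x. (\<lambda>y. x + y) ` W)"
  have "z \<in> \<Union>?\<F>" for z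
  proof -
    have "z \<in> (\<lambda>y. (z + - w) + y) ` W"
      using \<open>w \<in> W\<close> by (intro image_eqI[of _ _ w]) (simp_all add: add.assoc)
    then show ?thesis by blast
  qed
  then have cover: "\<Union>?\<F> = UNIV" by blast
  obtain \<F> where \<F>: "\<F> \<subseteq> ?\<F>" "countable \<F>" "\<Union>\<F> = \<Union>?\<F>"
    using Lindelof[of ?\<F>] W(1) open_left_translation by blast
  have sets: "sets \<mu> = sets borel"
    and inv: "emeasure \<mu> ((\<lambda>y. x + y) ` W) = emeasure \<mu> W" for x
    using \<mu> W(1) by (auto simp: haar_measure_def)
  have "A \<in> null_sets \<mu>" if "A \<in> \<F>" for A
    using that \<F>(1) W(1) by (auto simp: null_sets_def sets inv 0 open_left_translation)
  then have "(\<Union>A\<in>\<F>. A) \<in> null_sets \<mu>" using \<F>(2) by (intro null_sets_UN') auto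
  then have "emeasure \<mu> UNIV = 0" using \<F>(3) cover by (simp add: null_sets_def)
  then show False using \<mu> by (simp add: haar_measure_def)
qed

section \<open>Projective representations\<close>

lemma continuous_on_matrix_coefficient:
  assumes "projective_unitary_rep \<pi>"
  shows "continuous_on UNIV (\<lambda>x. cinner f (\<pi> x g))"
  using assms continuous_on_compose2[OF continuous_on_cinner_right, of UNIV "\<lambda>x. \<pi> x g"]
  by (auto simp: projective_unitary_rep_def)

lemma norm_unitary:
  assumes "unitary_operator U"
  shows "norm (U f) = norm f"
proof -
  have "complex_of_real ((norm (U f))\<^sup>2) = complex_of_real ((norm f)\<^sup>2)"
    using assms by (simp only: cinner_self[symmetric] unitary_operator_def)
  then show ?thesis by (simp only: of_real_eq_iff power2_eq_iff_nonneg norm_ge_zero)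
qed

lemma unitary_module_hom: "unitary_operator U \<Longrightarrow> module_hom scaleC scaleC U"
  by (simp add: unitary_operator_def Vector_Spaces.linear_iff_module_hom)

text \<open>By the orthogonality relations, the integral of \<open>\<parallel>P \<pi>(y) \<phi>\<parallel>\<^sup>2\<close> over \<open>G\<close> is the trace of \<open>P\<close> divided
  by \<open>d\<close>, where \<open>P\<close> is the orthogonal projection onto the span of \<open>B\<close>.\<close>

lemma approximation_dimension_bound:
  assumes \<pi>: "projective_unitary_rep \<pi>" and d: "has_formal_degree \<mu> \<pi> d"
    and sets: "sets \<mu> = sets borel" and X: "X \<in> sets \<mu>"
    and B: "finite B" and \<phi>: "norm \<phi> = 1"
    and approx: "\<And>y. y \<in> X \<Longrightarrow> \<exists>v\<in>complex_vector.span B. norm (\<pi> y \<phi> - v) \<le> \<epsilon>"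
  shows "ennreal (1 - \<epsilon>\<^sup>2) * emeasure \<mu> X \<le> ennreal (real (card B) / d)"
proof -
  obtain E where E: "finite E" "card E \<le> card B" "orthonormal E" "B \<subseteq> complex_vector.span E"
    using orthonormal_spanning_set[OF B] by blast
  have d0: "d > 0" and deg: "\<And>f. (\<integral>\<^sup>+ y. ennreal ((cmod (cinner f (\<pi> y \<phi>)))\<^sup>2) \<partial>\<mu>)
      = ennreal ((norm f)\<^sup>2 * (norm \<phi>)\<^sup>2 / d)"
    using d by (auto simp: has_formal_degree_def)
  have norm1: "norm e = 1" if "e \<in> E" for e
  proof -
    have "complex_of_real ((norm e)\<^sup>2) = complex_of_real 1"
      using E(3) that by (simp only: cinner_self[symmetric] orthonormal_def of_real_1) simp
    then have "(norm e)\<^sup>2 = 1" by (simp only: of_real_eq_iff)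
    then show ?thesis by (simp add: power2_eq_1_iff) (use norm_ge_zero[of e] in linarith)
  qed
  \<comment> \<open>\<open>\<pi> y \<phi>\<close> is a unit vector \<open>\<epsilon>\<close>-close
    to the span of \<open>E\<close>, so its projection keeps square norm at least
    \<open>1 - \<epsilon>\<^sup>2\<close>.\<close>
  have pt: "ennreal (1 - \<epsilon>\<^sup>2) \<le> (\<Sum>e\<in>E. ennreal ((cmod (cinner e (\<pi> y \<phi>)))\<^sup>2))" if y: "y \<in> X" for y
  proof -
    obtain v where v: "v \<in> complex_vector.span B" "norm (\<pi> y \<phi> - v) \<le> \<epsilon>" using approx[OF y] by blast
    have "v \<in> complex_vector.span E"
      using v(1) E(4) complex_vector.span_mono[OF E(4)] by (auto simp: complex_vector.span_span)
    from bessel_approximation[OF E(3,1) this, of "\<pi> y \<phi>"]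
    have "1 - (norm (\<pi> y \<phi> - v))\<^sup>2 \<le> (\<Sum>e\<in>E. (cmod (cinner e (\<pi> y \<phi>)))\<^sup>2)"
      using \<pi> \<phi> by (simp add: projective_unitary_rep_def norm_unitary)
    moreover have "(norm (\<pi> y \<phi> - v))\<^sup>2 \<le> \<epsilon>\<^sup>2" using v(2) by (intro power_mono) auto
    ultimately show ?thesis by (subst sum_ennreal) (auto intro!: ennreal_leI)
  qed
  have "ennreal (1 - \<epsilon>\<^sup>2) * emeasure \<mu> X = (\<integral>\<^sup>+ y. ennreal (1 - \<epsilon>\<^sup>2) * indicator X y \<partial>\<mu>)"
    using X by (simp add: nn_integral_cmult_indicator)
  also have "\<dots> \<le> (\<integral>\<^sup>+ y. (\<Sum>e\<in>E. ennreal ((cmod (cinner e (\<pi> y \<phi>)))\<^sup>2)) \<partial>\<mu>)"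
    by (intro nn_integral_mono) (auto simp: indicator_def pt simp del: sum_ennreal)
  also have "\<dots> = (\<Sum>e\<in>E. \<integral>\<^sup>+ y. ennreal ((cmod (cinner e (\<pi> y \<phi>)))\<^sup>2) \<partial>\<mu>)"
  proof (intro nn_integral_sum)
    fix e
    have "(\<lambda>y. cinner e (\<pi> y \<phi>)) \<in> borel_measurable \<mu>"
      using borel_measurable_continuous_onI[OF continuous_on_matrix_coefficient[OF \<pi>]]
      by (simp add: measurable_cong_sets[OF sets refl])
    then show "(\<lambda>y. ennreal ((cmod (cinner e (\<pi> y \<phi>)))\<^sup>2)) \<in> borel_measurable \<mu>" by measurable
  qed
  also have "\<dots> = (\<Sum>e\<in>E. ennreal (1 / d))" by (simp add: deg norm1 \<phi>)
  also have "\<dots> = ennreal (real (card E) / d)"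
    using d0 by (simp add: ennreal_of_nat_eq_real_of_nat ennreal_mult[symmetric])
  also have "\<dots> \<le> ennreal (real (card B) / d)"
    using E(2) d0 by (intro ennreal_leI divide_right_mono) auto
  finally show ?thesis .
qed

text \<open>Completeness gives this with a fixed finite set of translates for \<open>z\<close> in a compact set;
  translating by \<open>\<Lambda>\<close> makes it uniform on \<open>G\<close>, at the cost of replacing \<open>\<Lambda>\<close> by \<open>\<Lambda> + \<Lambda>\<close>.\<close>

lemma complete_system_uniform_approx:
  assumes \<pi>: "projective_unitary_rep \<pi>" and complete: "complete_system \<pi> \<Lambda> g"
    and dense: "relatively_dense \<Lambda>" and \<epsilon>: "\<epsilon> > 0"
  shows "\<exists>L. compact L \<and> (\<forall>z. \<exists>v\<in>complex_vector.span
    ((\<lambda>x. \<pi> x g) ` ((\<Lambda> + \<Lambda>) \<inter> (\<lambda>y. z + y) ` L)). norm (\<pi> z \<phi> - v) \<le> \<epsilon>)"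
proof -
  obtain K where K: "compact K" "\<Lambda> + K = UNIV" using dense by (auto simp: relatively_dense_def)
  obtain \<sigma> where \<sigma>1: "\<And>x y. cmod (\<sigma> x y) = 1"
    and \<sigma>: "\<And>x y f. \<pi> x (\<pi> y f) = scaleC (\<sigma> x y) (\<pi> (x + y) f)"
    using \<pi> by (auto simp: projective_unitary_rep_def two_cocycle_def)
  have U: "unitary_operator (\<pi> x)" for x using \<pi> by (simp add: projective_unitary_rep_def)
  have "continuous_on K (\<lambda>x. \<pi> x \<phi>)"
    using \<pi> continuous_on_subset by (fastforce simp: projective_unitary_rep_def)
  then have "compact ((\<lambda>x. \<pi> x \<phi>) ` K)" using K(1) by (rule compact_continuous_image)
  moreover have "closure (complex_vector.span ((\<lambda>x. \<pi> x g) ` \<Lambda>)) = UNIV"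
    using complete by (simp add: complete_system_def)
  ultimately have "\<exists>T. finite T \<and> T \<subseteq> (\<lambda>x. \<pi> x g) ` \<Lambda> \<and>
      (\<forall>u\<in>(\<lambda>x. \<pi> x \<phi>) ` K. \<exists>v\<in>complex_vector.span T. norm (u - v) \<le> \<epsilon>)"
    by (intro span_closure_finite_approx \<epsilon>) auto
  then obtain T where T: "finite T" "T \<subseteq> (\<lambda>x. \<pi> x g) ` \<Lambda>"
      "\<And>u. u \<in> (\<lambda>x. \<pi> x \<phi>) ` K \<Longrightarrow> \<exists>v\<in>complex_vector.span T. norm (u - v) \<le> \<epsilon>"
    by blast
  obtain A where A: "finite A" "A \<subseteq> \<Lambda>" "T = (\<lambda>x. \<pi> x g) ` A"
    using T(1,2) by (meson finite_subset_image)
  \<comment> \<open>For \<open>z = l + y\<close> with \<open>l \<in> \<Lambda>\<close> and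
    \<open>y \<in> K\<close>, applying \<open>\<pi> l\<close> to an approximation of
    \<open>\<pi> y \<phi>\<close> involves the points \<open>l + a = z + (- y + a)\<close>;
    \<open>L\<close> collects the \<open>- y + a\<close>.\<close>
  define L where "L = uminus ` K + A"
  have "compact L" unfolding L_def
    by (intro compact_set_plus compact_continuous_image[OF _ K(1)] finite_imp_compact[OF A(1)]
        continuous_intros)
  moreover have "\<exists>v\<in>complex_vector.span ((\<lambda>x. \<pi> x g) ` ((\<Lambda> + \<Lambda>) \<inter> (\<lambda>y. z + y) ` L)).
      norm (\<pi> z \<phi> - v) \<le> \<epsilon>" (is "\<exists>v\<in>complex_vector.span ?S. _") for z
  proof -
    obtain l y where ly: "l \<in> \<Lambda>" "y \<in> K" "z = l + y"
      using K(2) by (metis UNIV_I set_plus_elim)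
    obtain v where v: "v \<in> complex_vector.span T" "norm (\<pi> y \<phi> - v) \<le> \<epsilon>"
      using T(3) ly(2) by blast
    have S: "\<pi> l (\<pi> a g) \<in> complex_vector.span ?S" if "a \<in> A" for a
    proof -
      have "l + a = z + (- y + a)" by (simp add: ly(3) add.assoc)
      moreover have "- y + a \<in> L" using that ly(2) by (auto simp: L_def)
      moreover have "l + a \<in> \<Lambda> + \<Lambda>" using that A(2) ly(1) by auto
      ultimately have "\<pi> (l + a) g \<in> ?S" by blast
      then show ?thesis unfolding \<sigma>
        by (intro complex_vector.span_scale complex_vector.span_base)
    qed
    note hom = unitary_module_hom[OF U[of l]]
    have v': "\<pi> l v \<in> complex_vector.span ?S" using v(1)
    proof (induction rule: complex_vector.span_induct_alt)
      case base then show ?case by (simp add: module_hom.zero[OF hom] complex_vector.span_zero)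
    next
      case (step c x y)
      then show ?case using S A(3)
        by (auto simp: module_hom.add[OF hom] module_hom.scale[OF hom]
            intro!: complex_vector.span_add complex_vector.span_scale)
    qed
    \<comment> \<open>\<open>\<pi> l (\<pi> y \<phi>)\<close> is \<open>\<pi> z \<phi>\<close> up to
      the phase \<open>\<sigma> l y\<close>; dividing by it preserves both the span and the
      norms.\<close>
    have "\<sigma> l y \<noteq> 0" using \<sigma>1[of l y] by auto
    then have "\<pi> z \<phi> - scaleC (inverse (\<sigma> l y)) (\<pi> l v)
        = scaleC (inverse (\<sigma> l y)) (\<pi> l (\<pi> y \<phi> - v))"
      by (simp add: module_hom.diff[OF hom] complex_vector.scale_right_diff_distrib \<sigma> ly(3)
          scaleC_scaleC scaleC_one)
    then have "norm (\<pi> z \<phi> - scaleC (inverse (\<sigma> l y)) (\<pi> l v)) = norm (\<pi> y \<phi> - v)"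
      by (simp add: norm_scaleC norm_inverse \<sigma>1 norm_unitary[OF U])
    then show ?thesis using v(2) v' complex_vector.span_scale by metis
  qed
  ultimately show ?thesis by blast
qed

section \<open>Counting points of approximate lattices\<close>

text \<open>The factor \<open>k\<close> of the density bound arises here: a point of
  \<open>\<Lambda> + \<Lambda>\<close> in the window is determined by a point of
  \<open>\<Lambda>\<close> in the enlarged window and one of at most \<open>k\<close> elements of
  \<open>F\<close>.\<close>

lemma product_set_card_le:
  assumes "approximate_subgroup k \<Lambda>"
  obtains F where "finite F"
    "\<And>S. finite (\<Lambda> \<inter> (S + F)) \<Longrightarrow>
      finite ((\<Lambda> + \<Lambda>) \<inter> S) \<and> card ((\<Lambda> + \<Lambda>) \<inter> S) \<le> k * card (\<Lambda> \<inter> (S + F))"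
proof -
  obtain F where F: "finite F" "card F \<le> k" "\<Lambda> + \<Lambda> \<subseteq> F + \<Lambda>" and sym: "uminus ` \<Lambda> = \<Lambda>"
    using assms by (auto simp: approximate_subgroup_def)
  have "finite ((\<Lambda> + \<Lambda>) \<inter> S) \<and> card ((\<Lambda> + \<Lambda>) \<inter> S) \<le> k * card (\<Lambda> \<inter> (S + F))"
    if fin: "finite (\<Lambda> \<inter> (S + F))" for S
  proof -
    let ?I = "(\<lambda>(f, l). l + - f) ` (F \<times> (\<Lambda> \<inter> (S + F)))"
    \<comment> \<open>Inverting \<open>\<Lambda> + \<Lambda> \<subseteq> F + \<Lambda>\<close> moves the finite set to the right, so that it acts on the window
      \<open>S\<close> as a bounded perturbation and not as a left translation.\<close>
    have "s \<in> ?I" if s: "s \<in> \<Lambda> + \<Lambda>" "s \<in> S" for s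
    proof -
      obtain a b where ab: "a \<in> \<Lambda>" "b \<in> \<Lambda>" "s = a + b" using s(1) by (auto elim: set_plus_elim)
      have neg: "- x \<in> \<Lambda>" if "x \<in> \<Lambda>" for x using sym that by blast
      have "- b + - a \<in> F + \<Lambda>" using F(3) neg ab by blast
      then obtain f l where fl: "f \<in> F" "l \<in> \<Lambda>" "- b + - a = f + l" by (auto elim: set_plus_elim)
      have "s = - (- b + - a)" by (simp only: ab(3) minus_add minus_minus)
      also have "\<dots> = - l + - f" unfolding fl(3) by (rule minus_add)
      finally have s_eq: "s = - l + - f" .
      then have "- l = s + f" by (simp add: add.assoc)
      then have "- l \<in> \<Lambda> \<inter> (S + F)" using neg[OF fl(2)] s(2) fl(1) by auto
      with fl(1) s_eq show ?thesis by (intro image_eqI[of _ _ "(f, - l)"]) simp_all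
    qed
    then have sub: "(\<Lambda> + \<Lambda>) \<inter> S \<subseteq> ?I" by blast
    have finI: "finite ?I" using F(1) fin by blast
    have "card ?I \<le> card F * card (\<Lambda> \<inter> (S + F))"
      using card_image_le[of "F \<times> (\<Lambda> \<inter> (S + F))"] F(1) fin by (metis card_cartesian_product finite_cartesian_product)
    also have "\<dots> \<le> k * card (\<Lambda> \<inter> (S + F))" using F(2) by simp
    finally show ?thesis
      using card_mono[OF finI sub] finite_subset[OF sub finI] by linarith
  qed
  then show thesis using F(1) that by blast
qed

text \<open>If \<open>l + w = m + w'\<close> with \<open>w\<close>, \<open>w'\<close> in
  \<open>W\<close>, then \<open>l\<close> and \<open>m\<close> share a translate of
  \<open>V\<close>, so they agree. Keeping \<open>W\<close> inside a compact set gives it finite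
  Haar measure.\<close>

lemma uniformly_discrete_disjoint_translates:
  fixes \<Lambda> :: "'g::topological_group_add set"
  assumes "locally_compact_space (euclidean :: 'g topology)" "uniformly_discrete \<Lambda>"
  obtains W C where "open W" "0 \<in> W" "W \<subseteq> C" "compact C"
    "disjoint_family_on (\<lambda>l. (\<lambda>y. l + y) ` W) \<Lambda>"
proof -
  obtain V v where V: "open V" "v \<in> V"
      "\<And>x. finite (\<Lambda> \<inter> (\<lambda>y. x + y) ` V) \<and> card (\<Lambda> \<inter> (\<lambda>y. x + y) ` V) \<le> 1"
    using assms(2) unfolding uniformly_discrete_def by blast
  obtain U C where C: "open U" "compact C" "(0::'g) \<in> U" "U \<subseteq> C"
    using assms(1) by (simp add: locally_compact_space_def) blast
  \<comment> \<open>For \<open>z = l + w\<close> this makes \<open>l = (z + - v) + (v + - w)\<close>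
    a point of a translate of \<open>V\<close> that depends on \<open>z\<close> only.\<close>
  define W where "W = U \<inter> (\<lambda>w. v + - w) -` V"
  have "open W" unfolding W_def
    using C(1) V(1) by (intro open_Int open_vimage continuous_intros)
  moreover have "disjoint_family_on (\<lambda>l. (\<lambda>y. l + y) ` W) \<Lambda>"
    unfolding disjoint_family_on_def
  proof (intro ballI impI, rule ccontr)
    fix l m assume lm: "l \<in> \<Lambda>" "m \<in> \<Lambda>" "l \<noteq> m" "(\<lambda>y. l + y) ` W \<inter> (\<lambda>y. m + y) ` W \<noteq> {}"
    then obtain z w w' where z: "z = l + w" "z = m + w'" "w \<in> W" "w' \<in> W" by blast
    let ?P = "\<Lambda> \<inter> (\<lambda>y. (z + - v) + y) ` V"
    have "l = (z + - v) + (v + - w)"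
      by (simp only: z(1) add.assoc minus_add_cancel right_minus add_0_right)
    moreover have "m = (z + - v) + (v + - w')"
      by (simp only: z(2) add.assoc minus_add_cancel right_minus add_0_right)
    moreover have "v + - w \<in> V" "v + - w' \<in> V" using z(3,4) by (auto simp: W_def)
    ultimately have "l \<in> ?P" "m \<in> ?P" using lm(1,2) by (metis IntI imageI)+
    then have "{l, m} \<subseteq> ?P" by blast
    then have "card {l, m} \<le> 1" using V(3) card_mono le_trans by meson
    then show False using lm(3) by simp
  qed
  ultimately show thesis using C V(2) that[of W C] by (auto simp: W_def)
qed

text \<open>The translates of \<open>W\<close> by \<open>P\<close> are disjoint, have equal measure
  by left invariance, and all lie in the translate of \<open>T\<close> by \<open>x\<close>.\<close>

lemma packing_bound:
  assumes \<mu>: "haar_measure \<mu>" and W: "open W"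
    and disj: "disjoint_family_on (\<lambda>l. (\<lambda>y. l + y) ` W) \<Lambda>"
    and P: "finite P" "P \<subseteq> \<Lambda> \<inter> (\<lambda>y. x + y) ` S" and T: "T \<in> sets borel" "S + W \<subseteq> T"
  shows "of_nat (card P) * emeasure \<mu> W \<le> emeasure \<mu> T"
proof -
  have sets: "sets \<mu> = sets borel" and inv: "\<And>x A. A \<in> sets borel \<Longrightarrow> emeasure \<mu> ((\<lambda>y. x + y) ` A) = emeasure \<mu> A"
    using \<mu> by (auto simp: haar_measure_def)
  have "of_nat (card P) * emeasure \<mu> W = (\<Sum>l\<in>P. emeasure \<mu> ((\<lambda>y. l + y) ` W))"
    using W by (simp add: inv)
  also have "\<dots> = emeasure \<mu> (\<Union>l\<in>P. (\<lambda>y. l + y) ` W)"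
    using P W disj by (intro sum_emeasure)
      (auto simp: sets open_left_translation intro: disjoint_family_on_mono)
  also have "\<dots> \<le> emeasure \<mu> ((\<lambda>y. x + y) ` T)"
  proof (rule emeasure_mono)
    show "(\<lambda>y. x + y) ` T \<in> sets \<mu>" using T(1) by (simp add: sets borel_left_translation)
    show "(\<Union>l\<in>P. (\<lambda>y. l + y) ` W) \<subseteq> (\<lambda>y. x + y) ` T"
    proof clarify
      fix l w assume "l \<in> P" "w \<in> W"
      then obtain s where "s \<in> S" "l = x + s" using P(2) by blast
      moreover have "s + w \<in> T" using T(2) \<open>s \<in> S\<close> \<open>w \<in> W\<close> by blast
      ultimately show "l + w \<in> (\<lambda>y. x + y) ` T"
        by (intro image_eqI[of _ _ "s + w"]) (simp_all add: add.assoc)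
    qed
  qed
  also have "\<dots> = emeasure \<mu> T" using T(1) by (rule inv)
  finally show ?thesis .
qed

lemma boundary_points_card:
  assumes \<mu>: "haar_measure \<mu>" and W: "open W" "0 < measure \<mu> W"
    and disj: "disjoint_family_on (\<lambda>l. (\<lambda>y. l + y) ` W) \<Lambda>"
    and T: "T \<in> sets borel" "emeasure \<mu> T < \<infinity>" "S + W \<subseteq> T"
  shows "finite (\<Lambda> \<inter> (\<lambda>y. x + y) ` S)"
    and "real (card (\<Lambda> \<inter> (\<lambda>y. x + y) ` S)) * measure \<mu> W \<le> measure \<mu> T"
proof -
  \<comment> \<open>\<open>measure\<close> sends infinite measure to 0, so positivity already forces
    \<open>W\<close> to have finite measure.\<close>
  have W': "emeasure \<mu> W = ennreal (measure \<mu> W)"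
    using W(2) by (intro emeasure_eq_ennreal_measure) (auto simp: measure_def)
  have bound: "real (card P) * measure \<mu> W \<le> measure \<mu> T"
    if "finite P" "P \<subseteq> \<Lambda> \<inter> (\<lambda>y. x + y) ` S" for P
  proof -
    have "of_nat (card P) * ennreal (measure \<mu> W) \<le> ennreal (measure \<mu> T)"
      using packing_bound[OF \<mu> W(1) disj that T(1,3)] T(2) W' emeasure_eq_ennreal_measure[of \<mu> T]
      by simp
    then show ?thesis
      by (simp add: ennreal_of_nat_eq_real_of_nat ennreal_mult[symmetric])
  qed
  \<comment> \<open>Finiteness of the whole set is not yet known, so the packing bound is first
    applied to its finite subsets.\<close>
  have "card P \<le> nat \<lfloor>measure \<mu> T / measure \<mu> W\<rfloor>"
    if "P \<subseteq> \<Lambda> \<inter> (\<lambda>y. x + y) ` S" "finite P" for P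
    using bound[OF that(2,1)] W(2) by (simp add: le_nat_iff le_floor_iff field_simps)
  then show "finite (\<Lambda> \<inter> (\<lambda>y. x + y) ` S)"
    by (rule finite_if_finite_subsets_card_bdd[THEN conjunct1])
  then show "real (card (\<Lambda> \<inter> (\<lambda>y. x + y) ` S)) * measure \<mu> W \<le> measure \<mu> T"
    by (intro bound) auto
qed

section \<open>The density theorem\<close>

theorem theorem1p1:
  fixes \<mu> :: "'g::{topological_group_add, t2_space, second_countable_topology} measure"
    and Ks :: "nat \<Rightarrow> 'g set"
    and \<Lambda> :: "'g set"
    and k :: nat
    and \<pi> :: "'g \<Rightarrow> 'h::complex_hilbert_space \<Rightarrow> 'h"
    and d :: real
  assumes "locally_compact_space (euclidean :: 'g topology)"
    and "haar_measure \<mu>"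
    and "amenable \<mu>"
    and "unimodular \<mu>"
    and "strong_folner \<mu> Ks"
    and "uniform_approximate_lattice k \<Lambda>"
    and "projective_unitary_rep \<pi>"
    and "irreducible_rep \<pi>"
    and "square_integrable_rep \<mu> \<pi>"
    and "has_formal_degree \<mu> \<pi> d"
    and "\<exists>g. complete_system \<pi> \<Lambda> g"
  shows "lower_beurling_density \<mu> Ks \<Lambda> \<ge> ennreal (d / real k)"
proof -
  have \<mu>: "haar_measure \<mu>" and \<pi>: "projective_unitary_rep \<pi>" and deg: "has_formal_degree \<mu> \<pi> d"
    by fact+
  have app: "approximate_subgroup k \<Lambda>" and dense: "relatively_dense \<Lambda>" and disc: "uniformly_discrete \<Lambda>"
    using assms(6) by (auto simp: uniform_approximate_lattice_def delone_def)
  have sets: "sets \<mu> = sets borel" and compact_fin: "\<And>K. compact K \<Longrightarrow> emeasure \<mu> K < \<infinity>"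
    and inv: "\<And>x A. A \<in> sets borel \<Longrightarrow> emeasure \<mu> ((\<lambda>y. x + y) ` A) = emeasure \<mu> A"
    using \<mu> by (auto simp: haar_measure_def)
  have d0: "d > 0" using deg by (simp add: has_formal_degree_def)
  obtain g where g: "complete_system \<pi> \<Lambda> g" using assms(11) by blast
  obtain g0 :: 'h where "g0 \<noteq> 0" using assms(9) by (auto simp: square_integrable_rep_def)
  then have "norm (scaleC (1 / of_real (norm g0)) g0) = 1"
    by (simp add: norm_scaleC norm_divide)
  then obtain \<phi> :: 'h where \<phi>: "norm \<phi> = 1" by blast
  obtain W C where W: "open W" "0 \<in> W" "W \<subseteq> C" "compact C"
    and disj: "disjoint_family_on (\<lambda>l. (\<lambda>y. l + y) ` W) \<Lambda>"
    using uniformly_discrete_disjoint_translates[OF assms(1) disc] by blast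
  have "emeasure \<mu> W \<le> emeasure \<mu> C"
    using W(3,4) by (intro emeasure_mono) (auto simp: sets compact_imp_closed)
  then have "emeasure \<mu> W < \<infinity>" using compact_fin[OF W(4)] by (rule le_less_trans)
  moreover have "emeasure \<mu> W \<noteq> 0" using haar_measure_open_pos[OF \<mu> W(1)] W(2) by blast
  ultimately have w0: "0 < measure \<mu> W"
    by (simp add: measure_def enn2real_positive_iff zero_less_iff_neq_zero)
  obtain F where F: "finite F" and card_F: "\<And>S. finite (\<Lambda> \<inter> (S + F)) \<Longrightarrow>
      finite ((\<Lambda> + \<Lambda>) \<inter> S) \<and> card ((\<Lambda> + \<Lambda>) \<inter> S) \<le> k * card (\<Lambda> \<inter> (S + F))"
    using product_set_card_le[OF app] by blast
  show ?thesis unfolding lower_beurling_density_def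
  proof (rule dense_le)
    fix c assume c: "c < ennreal (d / real k)"
    then obtain r where r: "c = ennreal r" "0 \<le> r" by (cases c) auto
    have rd: "r < d / real k" using c unfolding r(1) by (simp add: ennreal_less_iff r(2))
    \<comment> \<open>For \<open>k = 0\<close> the quotient \<open>d / real k\<close> is 0 by
      convention, contradicting \<open>0 \<le> r\<close>.\<close>
    then have k0: "0 < k" using r(2) by (cases k) auto
    \<comment> \<open>This slack is spent in halves: one absorbs the loss
      \<open>\<epsilon>\<^sup>2 * d / real k\<close>, the other the points of
      \<open>\<Lambda>\<close> near the boundary of the window.\<close>
    define \<eta> where "\<eta> = d / real k - r"
    have \<eta>: "\<eta> > 0" using rd by (simp add: \<eta>_def)
    define \<epsilon> where "\<epsilon> = min 1 (\<eta> * real k / (2 * d))"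
    have \<epsilon>: "\<epsilon> > 0" using \<eta> k0 d0 by (simp add: \<epsilon>_def)
    have "\<epsilon> \<le> 1" by (simp add: \<epsilon>_def)
    then have "\<epsilon>\<^sup>2 \<le> \<epsilon>" using \<epsilon> by (simp add: power2_eq_square mult_left_le)
    then have "\<epsilon>\<^sup>2 \<le> \<eta> * real k / (2 * d)" by (simp add: \<epsilon>_def)
    then have \<epsilon>2: "\<epsilon>\<^sup>2 * d / real k \<le> \<eta> / 2" using d0 k0 by (simp add: field_simps)
    have \<epsilon>1: "\<epsilon>\<^sup>2 \<le> 1" using \<epsilon> \<open>\<epsilon> \<le> 1\<close> by (simp add: power_le_one)
    obtain L where L: "compact L" and approx: "\<And>z. \<exists>v\<in>complex_vector.span
        ((\<lambda>x. \<pi> x g) ` ((\<Lambda> + \<Lambda>) \<inter> (\<lambda>y. z + y) ` L)). norm (\<pi> z \<phi> - v) \<le> \<epsilon>"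
      using complete_system_uniform_approx[OF \<pi> g dense \<epsilon>] by blast
    \<comment> \<open>\<open>L\<close> is the reach of the approximation, \<open>F\<close> the cost
      of passing from \<open>\<Lambda> + \<Lambda>\<close> to \<open>\<Lambda>\<close>.\<close>
    define M where "M = L + F"
    \<comment> \<open>For \<open>s = a + m\<close> in \<open>Ks n + M\<close> but outside
      \<open>Ks n\<close>, and \<open>w \<in> W\<close>, the part \<open>M + C\<close> puts
      \<open>s + w\<close> into \<open>Ks n + M'\<close>, and the part \<open>C\<close> puts it into
      \<open>- Ks n + M'\<close>.\<close>
    define M' where "M' = (M + C) \<union> C"
    have "compact M" unfolding M_def by (intro compact_set_plus L finite_imp_compact F)
    then have M': "compact M'" unfolding M'_def using W(4) by (intro compact_Un compact_set_plus)
    have "M' \<noteq> {}" using W by (auto simp: M'_def)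
    with M' assms(5) have "(\<lambda>n. measure \<mu> ((Ks n + M') \<inter> (- Ks n + M')) / measure \<mu> (Ks n)) \<longlonglongrightarrow> 0"
      by (auto simp: strong_folner_def)
    \<comment> \<open>The threshold carries the factor \<open>measure \<mu> W\<close> because the
      packing bound is later divided by it.\<close>
    then have "\<forall>\<^sub>F n in sequentially.
        measure \<mu> ((Ks n + M') \<inter> (- Ks n + M')) / measure \<mu> (Ks n) < \<eta> / 2 * measure \<mu> W"
      using \<eta> w0 by (intro order_tendstoD(2)) auto
    then show "c \<le> liminf (\<lambda>n. INF x. emeasure (count_space UNIV) (\<Lambda> \<inter> (\<lambda>y. x + y) ` Ks n) / emeasure \<mu> (Ks n))"
    proof (intro Liminf_bounded, elim eventually_mono, intro INF_greatest)
      fix n x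
      let ?K = "Ks n"
      let ?T = "(?K + M') \<inter> (- ?K + M')"
      let ?P = "\<Lambda> \<inter> (\<lambda>y. x + y) ` ?K"
      let ?Q = "\<Lambda> \<inter> (\<lambda>y. x + y) ` (?K + M)"
      let ?R = "\<Lambda> \<inter> (\<lambda>y. x + y) ` ((?K + M) - ?K)"
      assume small: "measure \<mu> ?T / measure \<mu> ?K < \<eta> / 2 * measure \<mu> W"
      have K: "compact ?K" "emeasure \<mu> ?K \<noteq> 0" using assms(5) by (auto simp: strong_folner_def)
      have K_borel: "?K \<in> sets borel" using K(1) by (simp add: compact_imp_closed)
      have K_eq: "emeasure \<mu> ?K = ennreal (measure \<mu> ?K)"
        using compact_fin[OF K(1)] by (intro emeasure_eq_ennreal_measure) auto
      then have a0: "0 < measure \<mu> ?K" using K(2) by (cases "measure \<mu> ?K = 0") (auto simp: less_le)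
      have KM': "compact (?K + M')" using K(1) M' by (rule compact_set_plus)
      have "open (- ?K + M')" using K(1) by (intro open_set_plus_left) (simp add: compact_imp_closed open_Compl)
      then have T: "?T \<in> sets borel" using KM' by (simp add: compact_imp_closed)
      have "emeasure \<mu> ?T \<le> emeasure \<mu> (?K + M')"
        using KM' by (intro emeasure_mono) (auto simp: sets compact_imp_closed)
      then have T_fin: "emeasure \<mu> ?T < \<infinity>" using compact_fin[OF KM'] by (rule le_less_trans)
      have "((?K + M) - ?K) + W \<subseteq> ?T"
      proof
        fix z assume "z \<in> ((?K + M) - ?K) + W"
        then obtain s w where s: "s \<in> ?K + M" "s \<in> - ?K" "w \<in> W" "z = s + w"
          by (auto elim!: set_plus_elim[of _ "_ - _"])
        then obtain a m where am: "a \<in> ?K" "m \<in> M" "s = a + m" by (auto elim: set_plus_elim)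
        have "m + w \<in> M'" "w \<in> M'" using am(2) s(3) W(3) by (auto simp: M'_def)
        moreover have "z = a + (m + w)" using s(4) am(3) by (simp add: add.assoc)
        ultimately have "z \<in> ?K + M'" "z \<in> - ?K + M'"
          using set_plus_intro[OF am(1)] set_plus_intro[OF s(2)] s(4) by metis+
        then show "z \<in> ?T" by (rule IntI)
      qed
      note R = boundary_points_card[OF \<mu> W(1) w0 disj T T_fin this, of x]
      show "c \<le> emeasure (count_space UNIV) ?P / emeasure \<mu> ?K"
      proof (cases "finite ?P")
        \<comment> \<open>An infinite count over a window of finite measure gives the quotient
          \<open>\<infinity>\<close>.\<close>
        case False
        then show ?thesis by (simp add: K_eq ennreal_top_divide)
      next
        case True
        have "?Q \<subseteq> ?P \<union> ?R" by blast
        moreover from this have Q: "finite ?Q" using True R(1) by (meson finite_UnI finite_subset)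
        ultimately have card_Q: "card ?Q \<le> card ?P + card ?R"
          using True R(1) by (meson card_Un_le card_mono finite_UnI le_trans)
        let ?S = "(\<lambda>y. x + y) ` (?K + L)"
        \<comment> \<open>\<open>L\<close> and \<open>F\<close> are added on the right, so the
          translation by \<open>x\<close> stays outside and all bounds are uniform in
          \<open>x\<close>.\<close>
        have "?S + F = (\<lambda>y. x + y) ` (?K + M)"
          by (simp add: M_def left_translation_set_plus add.assoc)
        with card_F[of ?S] Q have B: "finite ((\<Lambda> + \<Lambda>) \<inter> ?S)" "card ((\<Lambda> + \<Lambda>) \<inter> ?S) \<le> k * card ?Q"
          by simp_all
        let ?B = "(\<lambda>x. \<pi> x g) ` ((\<Lambda> + \<Lambda>) \<inter> ?S)"
        have "ennreal (1 - \<epsilon>\<^sup>2) * emeasure \<mu> ((\<lambda>y. x + y) ` ?K) \<le> ennreal (real (card ?B) / d)"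
        proof (rule approximation_dimension_bound[OF \<pi> deg sets _ _ \<phi>])
          show "(\<lambda>y. x + y) ` ?K \<in> sets \<mu>" using K_borel by (simp add: sets borel_left_translation)
          show "finite ?B" using B(1) by (rule finite_imageI)
          fix z assume "z \<in> (\<lambda>y. x + y) ` ?K"
          then obtain a where a: "a \<in> ?K" "z = x + a" by blast
          have "(\<lambda>y. z + y) ` L \<subseteq> ?S"
          proof clarify
            fix l assume "l \<in> L"
            then show "z + l \<in> ?S"
              using a by (intro image_eqI[of _ _ "a + l"]) (auto simp: add.assoc)
          qed
          then have "(\<lambda>x. \<pi> x g) ` ((\<Lambda> + \<Lambda>) \<inter> (\<lambda>y. z + y) ` L) \<subseteq> ?B" by blast
          then show "\<exists>v\<in>complex_vector.span ?B. norm (\<pi> z \<phi> - v) \<le> \<epsilon>"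
            using approx[of z] complex_vector.span_mono by blast
        qed
        then have "(1 - \<epsilon>\<^sup>2) * measure \<mu> ?K \<le> real (card ?B) / d"
          using K_eq \<epsilon>1 d0 by (simp add: inv[OF K_borel] ennreal_mult[symmetric])
        moreover have "real (card ?B) \<le> real k * real (card ?Q)"
          unfolding of_nat_mult[symmetric] of_nat_le_iff
          using card_image_le[OF B(1), of "\<lambda>x. \<pi> x g"] B(2) by (rule le_trans)
        ultimately have "(1 - \<epsilon>\<^sup>2) * measure \<mu> ?K \<le> real k * real (card ?Q) / d"
          using d0 divide_right_mono[of "real (card ?B)" "real k * real (card ?Q)" d] by linarith
        then have "(1 - \<epsilon>\<^sup>2) * d / real k * measure \<mu> ?K \<le> real (card ?Q)"
          using d0 k0 by (simp add: field_simps)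
        \<comment> \<open>The first half of the slack pays for the approximation error; the second
          half pays for \<open>?R\<close> below.\<close>
        moreover have "(d / real k - \<eta> / 2) * measure \<mu> ?K \<le> (1 - \<epsilon>\<^sup>2) * d / real k * measure \<mu> ?K"
          using \<epsilon>2 a0 by (intro mult_right_mono) (auto simp: algebra_simps diff_divide_distrib)
        moreover have "real (card ?Q) \<le> real (card ?P) + real (card ?R)"
          using card_Q by (metis of_nat_add of_nat_le_iff)
        moreover have "real (card ?R) \<le> \<eta> / 2 * measure \<mu> ?K"
        proof -
          have "real (card ?R) * measure \<mu> W \<le> (\<eta> / 2 * measure \<mu> ?K) * measure \<mu> W"
            using R(2) small a0 by (simp add: field_simps)
          then show ?thesis using w0 by simp
        qed
        ultimately have "(d / real k - \<eta> / 2) * measure \<mu> ?K - \<eta> / 2 * measure \<mu> ?K \<le> real (card ?P)"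
          by linarith
        then have "r * measure \<mu> ?K \<le> real (card ?P)" by (simp add: \<eta>_def algebra_simps)
        then have "r \<le> real (card ?P) / measure \<mu> ?K" using a0 by (simp add: field_simps)
        then show ?thesis
          using True a0 by (simp add: r(1) K_eq emeasure_count_space_finite
              ennreal_of_nat_eq_real_of_nat divide_ennreal ennreal_leI)
      qed
    qed
  qed
qed

end
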